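(* Let $m,n\ge 2$ be natural numbers with $m<n$, and let $G\le \operatorname{Sym}(m)$ and $H\le \operatorname{Sym}(n)$. Suppose that: (1) there exists a prefix code $\widetilde{A}$ of $\mathfrak{C}_m$ with $|\widetilde{A}|=n$; (2) the root group $\mathcal{R}_G(\widetilde{A})$ is well defined; and (3) $\mathcal{R}_G(\widetilde{A})$ and $H$ are cyclically isomorphic. Then $V_n(H)$ embeds (as a group) in $V_m(G)$.
   Context: For $r\ge 2$ let $\mathcal{A}_r=\{0,1,\dots,r-1\}$ with the order $0<1<\dots<r-1$, let $\mathcal{A}_r^*$ be the set of finite words over $\mathcal{A}_r$ (including the empty word), and let $\mathfrak{C}_r=\mathcal{A}_r^{\mathbb{N}}$ (infinite words, product topology; a Cantor space). For $u\in\mathcal{A}_r^*$ and $v$ a finite or infinite word, $uv$ denotes concatenation, and $u\le_{pref} v$ means $v=uw$ for some word $w$. A (complete) prefix code of $\mathfrak{C}_r$ is a finite set $S\subset\mathcal{A}_r^*$ such that every infinite word $\zeta\in\mathfrak{C}_r$ has exactly one $s\in S$ with $s\le_{pref}\zeta$. A permutation $\sigma\in\operatorname{Sym}(r)$ acts on finite or infinite words letterwise: $\sigma(z_1z_2z_3\cdots)=\sigma(z_1)\sigma(z_2)\sigma(z_3)\cdots$. For $H\le\operatorname{Sym}(r)$, the symmetric Thompson group $V_r(H)$ is the group (under composition) of homeomorphisms of $\mathfrak{C}_r$ described by tables: a table consists of two prefix codes $P=\{p_1,\dots,p_k\}$ and $Q=\{q_1,\dots,q_k\}$ of $\mathfrak{C}_r$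 of the same size together with $\sigma_i,\tau_i\in H$ ($1\le i\le k$), and it describes the homeomorphism sending $p_i\,\sigma_i(u)\mapsto q_i\,\tau_i(u)$ for all $u\in\mathfrak{C}_r$ and all $i$ (equivalently $p_iu\mapsto q_i\,\tau_i\sigma_i^{-1}(u)$). Dictionary order on $\mathcal{A}_r^*$: $u\le_{dict}v$ iff $u\le_{pref}v$, or $u=p\alpha s$, $v=p\beta t$ with letters $\alpha<\beta$. Root group: given $G\le\operatorname{Sym}(m)$ and a prefix code $\widetilde{A}=\{a_0,\dots,a_{n-1}\}$ of $\mathfrak{C}_m$ listed in increasing dictionary order, the root group $\mathcal{R}_G(\widetilde{A})$ is well defined if $\sigma(\widetilde{A})=\widetilde{A}$ for every $\sigma\in G$ (letterwise action); it is then the group of permutations of $\widetilde{A}$ induced by the elements of $G$, regarded as a subgroup of $\operatorname{Sym}(n)$ via the bijection $i\mapsto a_i$ from $\mathcal{A}_n$ to $\widetilde{A}$. The cycle type of $\sigma\in\operatorname{Sym}(n)$ is the multiset of lengths of cycles in its cycle decomposition. Two subgroups $H,H'\le\operatorname{Sym}(n)$ are cyclically isomorphic if there is a group isomorphism $\psi:H\to H'$ with $\sigma$ and $\psi(\sigma)$ of the same cycle type for every $\sigma\in H$. *)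

theory Defs
  imports "HOL-Algebra.Group" "HOL-Combinatorics.Permutations" "HOL-Library.Multiset"
begin

definition cantor :: "nat \<Rightarrow> (nat \<Rightarrow> nat) set" where
  "cantor r = {z. \<forall>i. z i < r}"

definition words :: "nat \<Rightarrow> nat list set" where
  "words r = {u. \<forall>a\<in>set u. a < r}"

definition conc :: "nat list \<Rightarrow> (nat \<Rightarrow> nat) \<Rightarrow> (nat \<Rightarrow> nat)" where
  "conc u w = (\<lambda>i. if i < length u then u ! i else w (i - length u))"

definition pref_inf :: "nat list \<Rightarrow> (nat \<Rightarrow> nat) \<Rightarrow> bool" where
  "pref_inf u z \<longleftrightarrow> (\<forall>i<length u. z i = u ! i)"

definition prefix_code :: "nat \<Rightarrow> nat list set \<Rightarrow> bool" where
  "prefix_code r S \<longleftrightarrow> finite S \<and> S \<subseteq> words r \<and>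
     (\<forall>z\<in>cantor r. \<exists>!s. s \<in> S \<and> pref_inf s z)"

definition perm_subgroup :: "nat \<Rightarrow> (nat \<Rightarrow> nat) set \<Rightarrow> bool" where
  "perm_subgroup r H \<longleftrightarrow> H \<subseteq> {s. s permutes {..<r}} \<and> id \<in> H \<and>
     (\<forall>s\<in>H. \<forall>t\<in>H. s \<circ> t \<in> H) \<and> (\<forall>s\<in>H. Hilbert_Choice.inv s \<in> H)"

(* V_r(H): homeomorphisms of C_r given by tables; as functions on nat => nat
   they are taken to be the identity outside C_r (extensional representation). *)
definition Vset :: "nat \<Rightarrow> (nat \<Rightarrow> nat) set \<Rightarrow> ((nat \<Rightarrow> nat) \<Rightarrow> (nat \<Rightarrow> nat)) set" where
  "Vset r H = {f. (\<forall>z. z \<notin> cantor r \<longrightarrow> f z = z) \<and>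
     (\<exists>(ps :: nat list list) (qs :: nat list list) (ss :: (nat \<Rightarrow> nat) list) (ts :: (nat \<Rightarrow> nat) list).
        length qs = length ps \<and> length ss = length ps \<and> length ts = length ps \<and>
        distinct ps \<and> distinct qs \<and>
        prefix_code r (set ps) \<and> prefix_code r (set qs) \<and>
        set ss \<subseteq> H \<and> set ts \<subseteq> H \<and>
        (\<forall>i<length ps. \<forall>u\<in>cantor r.
            f (conc (ps ! i) ((ss ! i) \<circ> u)) = conc (qs ! i) ((ts ! i) \<circ> u)))}"

definition Vgrp :: "nat \<Rightarrow> (nat \<Rightarrow> nat) set \<Rightarrow> ((nat \<Rightarrow> nat) \<Rightarrow> (nat \<Rightarrow> nat)) monoid" where
  "Vgrp r H = \<lparr>carrier = Vset r H, monoid.mult = (\<circ>), one = id\<rparr>"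

definition dict_le :: "nat list \<Rightarrow> nat list \<Rightarrow> bool" where
  "dict_le u v \<longleftrightarrow> (\<exists>w. v = u @ w) \<or>
     (\<exists>p a b s t. a < b \<and> u = p @ a # s \<and> v = p @ b # t)"

definition dict_lt :: "nat list \<Rightarrow> nat list \<Rightarrow> bool" where
  "dict_lt u v \<longleftrightarrow> dict_le u v \<and> u \<noteq> v"

definition dict_enum :: "nat list set \<Rightarrow> nat list list" where
  "dict_enum A = (THE xs. sorted_wrt dict_lt xs \<and> distinct xs \<and> set xs = A)"

definition root_well_defined :: "(nat \<Rightarrow> nat) set \<Rightarrow> nat list set \<Rightarrow> bool" where
  "root_well_defined G A \<longleftrightarrow> (\<forall>s\<in>G. map s ` A = A)"

definition root_perm :: "nat list set \<Rightarrow> (nat \<Rightarrow> nat) \<Rightarrow> (nat \<Rightarrow> nat)" where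
  "root_perm A s = (\<lambda>i. if i < card A
       then (THE j. j < card A \<and> dict_enum A ! j = map s (dict_enum A ! i)) else i)"

definition root_group :: "(nat \<Rightarrow> nat) set \<Rightarrow> nat list set \<Rightarrow> (nat \<Rightarrow> nat) set" where
  "root_group G A = root_perm A ` G"

definition cycle_of :: "(nat \<Rightarrow> nat) \<Rightarrow> nat \<Rightarrow> nat set" where
  "cycle_of s x = {(s ^^ k) x | k. True}"

definition cycle_type :: "nat \<Rightarrow> (nat \<Rightarrow> nat) \<Rightarrow> nat multiset" where
  "cycle_type n s = image_mset card (mset_set (cycle_of s ` {..<n}))"

definition cyclically_isomorphic :: "nat \<Rightarrow> (nat \<Rightarrow> nat) set \<Rightarrow> (nat \<Rightarrow> nat) set \<Rightarrow> bool" where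
  "cyclically_isomorphic n H H' \<longleftrightarrow> (\<exists>\<psi>. bij_betw \<psi> H H' \<and>
     (\<forall>s\<in>H. \<forall>t\<in>H. \<psi> (s \<circ> t) = \<psi> s \<circ> \<psi> t) \<and>
     (\<forall>s\<in>H. cycle_type n (\<psi> s) = cycle_type n s))"

end

theory Submission
  imports Defs
begin

text \<open>
  Near each point \<open>x\<close> an element \<open>f\<close> of \<open>V\<^sub>n(H)\<close> has the form \<open>pu \<mapsto> q h(u)\<close>, and \<open>h\<close> depends only on
  \<open>f\<close> and \<open>x\<close>. This gives a cocycle \<open>c(f, x) \<in> H\<close>, so \<open>V\<^sub>n(H)\<close> acts on \<open>H \<times> \<CC>\<^sub>n\<close> by
  \<open>(k, x) \<mapsto> (c(f, x) k, f x)\<close>. In the coordinates \<open>(k, k\<^sup>-\<^sup>1 x)\<close> this action only replaces prefixes: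
  \<open>(k, k\<^sup>-\<^sup>1(p) u)\<close> is sent to \<open>(hk, (hk)\<^sup>-\<^sup>1(q) u)\<close>. The prefix code \<open>A\<close> identifies
  \<open>\<CC>\<^sub>n\<close> with \<open>\<CC>\<^sub>m\<close>, and placing the \<open>|H|\<close> copies of \<open>\<CC>\<^sub>n\<close> in disjoint cones of \<open>\<CC>\<^sub>m\<close> embeds \<open>V\<^sub>n(H)\<close>
  in \<open>V\<^sub>m(1) \<le> V\<^sub>m(G)\<close>.
\<close>

section \<open>Words and prefix codes\<close>

lemma conc_Nil [simp]: "conc [] z = z"
  by (simp add: conc_def)

lemma conc_append: "conc (u @ v) z = conc u (conc v z)"
  by (auto simp: conc_def nth_append fun_eq_iff)

lemma comp_conc: "s \<circ> conc u z = conc (map s u) (s \<circ> z)"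
  by (auto simp: conc_def fun_eq_iff)

lemma conc_cancel: "conc u y = conc u z \<longleftrightarrow> y = z"
proof
  assume eq: "conc u y = conc u z"
  show "y = z"
  proof
    fix i show "y i = z i"
      using fun_cong[OF eq, of "length u + i"] by (simp add: conc_def)
  qed
qed simp

lemma conc_cancel_same_length:
  assumes "conc u y = conc v z" "length u = length v"
  shows "u = v \<and> y = z"
proof -
  have "u = v"
  proof (rule nth_equalityI)
    fix i assume "i < length u"
    then show "u ! i = v ! i"
      using fun_cong[OF assms(1), of i] assms(2) by (simp add: conc_def)
  qed (rule assms(2))
  with assms(1) show ?thesis by (simp add: conc_cancel)
qed

lemma pref_inf_conc [simp]: "pref_inf u (conc u z)"
  by (simp add: pref_inf_def conc_def)

lemma conc_in_cantor: "u \<in> words r \<Longrightarrow> z \<in> cantor r \<Longrightarrow> conc u z \<in> cantor r"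
  by (auto simp: conc_def cantor_def words_def)

lemma pref_infE:
  assumes "pref_inf u z" "z \<in> cantor r"
  obtains y where "y \<in> cantor r" "z = conc u y"
proof
  show "(\<lambda>i. z (length u + i)) \<in> cantor r" using assms(2) by (simp add: cantor_def)
  show "z = conc u (\<lambda>i. z (length u + i))"
    using assms(1) by (auto simp: conc_def pref_inf_def fun_eq_iff)
qed

lemma pref_inf_append: "pref_inf (u @ v) (conc u z) \<longleftrightarrow> pref_inf v z"
proof
  assume *: "pref_inf (u @ v) (conc u z)"
  show "pref_inf v z" unfolding pref_inf_def
  proof (intro allI impI)
    fix i assume "i < length v"
    then show "z i = v ! i"
      using *[unfolded pref_inf_def, rule_format, of "length u + i"] by (simp add: conc_def nth_append)
  qed
qed (auto simp: pref_inf_def conc_def nth_append)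

lemma pref_inf_length_unique:
  "pref_inf u z \<Longrightarrow> pref_inf v z \<Longrightarrow> length u = length v \<Longrightarrow> u = v"
  by (auto simp: pref_inf_def intro: nth_equalityI)

lemma pref_inf_appendD: "pref_inf (u @ v) z \<Longrightarrow> pref_inf u z"
  by (fastforce simp: pref_inf_def nth_append)

text \<open>Uniqueness is assumed for the index and not just for the word: equal words at two
  indices would both be prefixes of that word extended by zeros, so \<open>p\<close> is injective.
  Partitions into cones can thus be handled through their index sets.\<close>

lemma prefix_code_family:
  assumes "r > 0" "finite I" "\<And>i. i \<in> I \<Longrightarrow> p i \<in> words r"
    and ex1: "\<And>z. z \<in> cantor r \<Longrightarrow> \<exists>!i. i \<in> I \<and> pref_inf (p i) z"
  shows "prefix_code r (p ` I)" "inj_on p I"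
proof -
  show "prefix_code r (p ` I)"
    unfolding prefix_code_def
  proof (intro conjI ballI)
    fix z assume "z \<in> cantor r"
    from ex1[OF this] show "\<exists>!s. s \<in> p ` I \<and> pref_inf s z" by blast
  qed (use assms in auto)
  show "inj_on p I"
  proof (rule inj_onI)
    fix i j assume ij: "i \<in> I" "j \<in> I" "p i = p j"
    have "(\<lambda>_. 0) \<in> cantor r" using \<open>r > 0\<close> by (simp add: cantor_def)
    then have "conc (p i) (\<lambda>_. 0) \<in> cantor r" by (intro conc_in_cantor assms ij)
    from ex1[OF this] ij show "i = j" by (metis pref_inf_conc)
  qed
qed

text \<open>The empty word is a prefix of every infinite word, so by uniqueness it leaves no room
  for a second code word. Nonempty code words ensure that substitution advances by at least one
  position per letter.\<close>

lemma prefix_code_nonempty_words: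
  assumes "prefix_code r A" "card A \<ge> 2" "r > 0" "s \<in> A"
  shows "s \<noteq> []"
proof
  assume "s = []"
  have "A \<subseteq> {[]}"
  proof
    fix t assume "t \<in> A"
    then have "conc t (\<lambda>_. 0) \<in> cantor r"
      using assms by (intro conc_in_cantor) (auto simp: prefix_code_def cantor_def)
    then have "\<exists>!s. s \<in> A \<and> pref_inf s (conc t (\<lambda>_. 0))"
      using assms(1) by (auto simp: prefix_code_def)
    moreover have "pref_inf [] (conc t (\<lambda>_. 0))" by (simp add: pref_inf_def)
    ultimately show "t \<in> {[]}" using \<open>t \<in> A\<close> \<open>s \<in> A\<close> \<open>s = []\<close> pref_inf_conc by blast
  qed
  from card_mono[OF _ this] assms(2) show False by simp
qed

section \<open>Table descriptions\<close>

text \<open>A table may be indexed by any finite set, with a single permutation per cone: the source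
  permutations are all taken to be \<open>id\<close>.\<close>

lemma Vset_intro:
  assumes "finite I" "inj_on p I" "inj_on q I"
    and "prefix_code r (p ` I)" "prefix_code r (q ` I)" "id \<in> H"
    and "\<And>i. i \<in> I \<Longrightarrow> h i \<in> H"
    and "\<And>i u. i \<in> I \<Longrightarrow> u \<in> cantor r \<Longrightarrow> f (conc (p i) u) = conc (q i) (h i \<circ> u)"
    and "\<And>z. z \<notin> cantor r \<Longrightarrow> f z = z"
  shows "f \<in> Vset r H"
proof -
  obtain xs where xs: "set xs = I" "distinct xs"
    using finite_distinct_list[OF assms(1)] by blast
  show ?thesis
    unfolding Vset_def
    apply (intro CollectI conjI)
    subgoal using assms by blast
    apply (rule exI[of _ "map p xs"], rule exI[of _ "map q xs"],
        rule exI[of _ "replicate (length xs) id"], rule exI[of _ "map h xs"])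
    using assms xs by (auto simp: distinct_map)
qed

text \<open>Substituting the inverse of the source permutation into \<open>u\<close> merges the two
  permutations of a table row into one, \<open>h p\<close>. The rows are indexed by the source words
  themselves.\<close>

lemma Vset_table:
  assumes "f \<in> Vset r H" "perm_subgroup r H"
  obtains P Q h where "prefix_code r P" "inj_on Q P" "prefix_code r (Q ` P)"
    "\<And>p. p \<in> P \<Longrightarrow> h p \<in> H"
    "\<And>p u. p \<in> P \<Longrightarrow> u \<in> cantor r \<Longrightarrow> f (conc p u) = conc (Q p) (h p \<circ> u)"
proof -
  from assms(1) obtain ps qs ss ts where t: "length qs = length ps" "length ss = length ps"
    "length ts = length ps" "distinct ps" "distinct qs" "prefix_code r (set ps)"
    "prefix_code r (set qs)" "set ss \<subseteq> H" "set ts \<subseteq> H"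
    and f: "\<And>i u. i < length ps \<Longrightarrow> u \<in> cantor r \<Longrightarrow>
      f (conc (ps ! i) ((ss ! i) \<circ> u)) = conc (qs ! i) ((ts ! i) \<circ> u)"
    unfolding Vset_def by blast
  define ix where "ix = inv_into {..<length ps} ((!) ps)"
  have bij: "bij_betw ((!) ps) {..<length ps} (set ps)"
    using t(4) by (simp add: bij_betw_nth)
  have ixb: "bij_betw ix (set ps) {..<length ps}"
    unfolding ix_def by (rule bij_betw_inv_into[OF bij])
  have ix: "ix p < length ps" "ps ! ix p = p" if "p \<in> set ps" for p
    using bij_betw_apply[OF ixb that] bij_betw_inv_into_right[OF bij that]
    by (auto simp: ix_def)
  have "bij_betw ((!) qs) {..<length ps} (set qs)"
    using t(5) t(1) by (metis bij_betw_nth)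
  then have Qb: "bij_betw (\<lambda>p. qs ! ix p) (set ps) (set qs)"
    using bij_betw_trans[OF ixb] by (simp add: comp_def)
  show thesis
  proof (rule that[of "set ps" "\<lambda>p. qs ! ix p" "\<lambda>p. (ts ! ix p) \<circ> Hilbert_Choice.inv (ss ! ix p)"])
    show "prefix_code r (set ps)" "inj_on (\<lambda>p. qs ! ix p) (set ps)"
      "prefix_code r ((\<lambda>p. qs ! ix p) ` set ps)"
      using t Qb by (auto simp: bij_betw_def)
  next
    fix p assume p: "p \<in> set ps"
    then have sH: "ss ! ix p \<in> H" "ts ! ix p \<in> H"
      using ix[OF p] t by (metis nth_mem subsetD)+
    then show "(ts ! ix p) \<circ> Hilbert_Choice.inv (ss ! ix p) \<in> H"
      using assms(2) by (simp add: perm_subgroup_def)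
    fix u assume u: "u \<in> cantor r"
    have perm: "ss ! ix p permutes {..<r}"
      using sH assms(2) by (auto simp: perm_subgroup_def)
    have "Hilbert_Choice.inv (ss ! ix p) \<circ> u \<in> cantor r"
      using u permutes_in_image[OF permutes_inv[OF perm]] by (auto simp: cantor_def)
    moreover have "ss ! ix p \<circ> (Hilbert_Choice.inv (ss ! ix p) \<circ> u) = u"
      using permutes_inverses[OF perm] by (auto simp: fun_eq_iff)
    ultimately show "f (conc p u) = conc (qs ! ix p) (((ts ! ix p) \<circ> Hilbert_Choice.inv (ss ! ix p)) \<circ> u)"
      using f[OF ix(1)[OF p], of "Hilbert_Choice.inv (ss ! ix p) \<circ> u"] ix(2)[OF p]
      by (simp add: comp_assoc)
  qed
qed

lemma permutes_comp_cantor: "s permutes {..<r} \<Longrightarrow> u \<in> cantor r \<Longrightarrow> s \<circ> u \<in> cantor r"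
  using permutes_in_image[of s "{..<r}"] by (auto simp: cantor_def)

lemma permutes_map_words: "s permutes {..<r} \<Longrightarrow> u \<in> words r \<Longrightarrow> map s u \<in> words r"
  using permutes_in_image[of s "{..<r}"] by (auto simp: words_def)

lemma Vset_maps_cantor:
  assumes "f \<in> Vset r H" "perm_subgroup r H" "x \<in> cantor r"
  shows "f x \<in> cantor r"
proof -
  obtain P Q h where t: "prefix_code r P" "prefix_code r (Q ` P)"
    "\<And>p. p \<in> P \<Longrightarrow> h p \<in> H"
    "\<And>p u. p \<in> P \<Longrightarrow> u \<in> cantor r \<Longrightarrow> f (conc p u) = conc (Q p) (h p \<circ> u)"
    using Vset_table[OF assms(1,2)] by metis
  obtain p where p: "p \<in> P" "pref_inf p x"
    using t(1) assms(3) by (auto simp: prefix_code_def)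
  then obtain u where u: "u \<in> cantor r" "x = conc p u"
    using pref_infE assms(3) by blast
  have "h p permutes {..<r}" using t(3)[OF p(1)] assms(2) by (auto simp: perm_subgroup_def)
  then have "h p \<circ> u \<in> cantor r" using u permutes_comp_cantor by blast
  moreover have "Q p \<in> words r" using t(2) p by (auto simp: prefix_code_def)
  ultimately show ?thesis using t(4)[OF p(1) u(1)] u(2) by (simp add: conc_in_cantor)
qed

section \<open>The local permutation cocycle\<close>

text \<open>Germwise form of \<open>pu \<mapsto> q h(u)\<close> with \<open>|p| = N\<close> and \<open>|q| = M\<close>.\<close>

definition local_form ::
  "nat \<Rightarrow> ((nat \<Rightarrow> nat) \<Rightarrow> nat \<Rightarrow> nat) \<Rightarrow> (nat \<Rightarrow> nat) \<Rightarrow> (nat \<Rightarrow> nat) \<Rightarrow> nat \<Rightarrow> nat \<Rightarrow> bool" where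
  "local_form r f x h N M \<longleftrightarrow> (\<forall>y\<in>cantor r. (\<forall>i<N. y i = x i) \<longrightarrow>
     (\<forall>i<M. f y i = f x i) \<and> (\<forall>i. f y (M + i) = h (y (N + i))))"

text \<open>Demanding that \<open>h\<close> permutes the alphabet fixes its values beyond the
  alphabet, where \<open>local_form\<close> says nothing, so that \<open>h\<close> can be unique as
  a function on all naturals.\<close>

definition local_perm :: "nat \<Rightarrow> ((nat \<Rightarrow> nat) \<Rightarrow> nat \<Rightarrow> nat) \<Rightarrow> (nat \<Rightarrow> nat) \<Rightarrow> nat \<Rightarrow> nat" where
  "local_perm r f x = (THE h. h permutes {..<r} \<and> (\<exists>N M. local_form r f x h N M))"

text \<open>If \<open>y\<close> shares \<open>d\<close> more letters with \<open>x\<close>, then the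
  next \<open>d\<close> output letters are the images under \<open>h\<close> of those shared letters
  and agree as well.\<close>

lemma local_form_refine:
  assumes "local_form r f x h N M" "x \<in> cantor r"
  shows "local_form r f x h (N + d) (M + d)"
  unfolding local_form_def
proof (intro ballI impI conjI allI)
  fix y assume y: "y \<in> cantor r" "\<forall>i<N + d. y i = x i"
  then have fy: "\<forall>i<M. f y i = f x i" "\<And>i. f y (M + i) = h (y (N + i))"
    using assms(1) by (auto simp: local_form_def)
  have fx: "f x (M + i) = h (x (N + i))" for i
    using assms by (auto simp: local_form_def)
  show "f y (M + d + i) = h (y (N + d + i))" for i
    using fy(2)[of "d + i"] by (simp add: add.assoc)
  fix i assume i: "i < M + d"
  show "f y i = f x i"
  proof (cases "i < M")
    case False
    then have "i = M + (i - M)" "N + (i - M) < N + d" using i by auto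
    then show ?thesis using fy(2)[of "i - M"] fx[of "i - M"] y(2) by auto
  qed (use fy in simp)
qed

lemma local_form_unique_aux:
  assumes "r \<ge> 2" "x \<in> cantor r" "h permutes {..<r}" "h' permutes {..<r}"
    and lf: "local_form r f x h N M" "local_form r f x h' N M'" and "M \<le> M'"
  shows "h = h'"
proof -
  \<comment> \<open>Each \<open>y a\<close> differs from \<open>x\<close> at most in the first
    letter beyond the common prefix. The first form makes output position \<open>M\<close> read
    \<open>h a\<close>.\<close>
  define y where "y a = x(N := a)" for a
  have y: "y a \<in> cantor r" "\<forall>i<N. y a i = x i" "y a N = a" if "a < r" for a
    using assms(2) that by (auto simp: y_def cantor_def)
  have 1: "f (y a) M = h a" if "a < r" for a
  proof -
    have "f (y a) (M + 0) = h (y a (N + 0))" using lf(1) y[OF that] unfolding local_form_def by blast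
    then show ?thesis using y[OF that] by simp
  qed
  have "M = M'"
  \<comment> \<open>If \<open>M < M'\<close>, the second form freezes output position
    \<open>M\<close>, so \<open>h\<close> would take the same value at the letters 0 and 1.\<close>
  proof (rule ccontr)
    assume "M \<noteq> M'"
    then have "f (y a) M = f x M" if "a < r" for a
      using lf(2) y[OF that] \<open>M \<le> M'\<close> unfolding local_form_def by (metis le_neq_implies_less)
    then have "h 0 = h 1" using 1[of 0] 1[of 1] \<open>r \<ge> 2\<close> by simp
    then show False using permutes_inj[OF assms(3)] by (metis injD zero_neq_one)
  qed
  have 2: "f (y a) M = h' a" if "a < r" for a
  proof -
    have "f (y a) (M' + 0) = h' (y a (N + 0))" using lf(2) y[OF that] unfolding local_form_def by blast
    then show ?thesis using y[OF that] \<open>M = M'\<close> by simp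
  qed
  show ?thesis
  proof
    fix a show "h a = h' a"
    proof (cases "a < r")
      case False
      then show ?thesis using assms(3,4) by (simp add: permutes_def)
    qed (use 1 2 in metis)
  qed
qed

text \<open>Refining each form by the input length of the other brings both to input length
  \<open>N + N'\<close>. By symmetry the output lengths may be taken in either order.\<close>

lemma local_form_unique:
  assumes "r \<ge> 2" "x \<in> cantor r" "h permutes {..<r}" "h' permutes {..<r}"
    and "local_form r f x h N M" "local_form r f x h' N' M'"
  shows "h = h'"
proof -
  have "local_form r f x h (N + N') (M + N')" "local_form r f x h' (N + N') (M' + N)"
    using local_form_refine[OF assms(5,2), of N'] local_form_refine[OF assms(6,2), of N]
    by (simp_all add: add.commute)
  then show ?thesis
    using local_form_unique_aux assms(1-4) by (metis nat_le_linear)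
qed

text \<open>Refine the form of \<open>g\<close> by \<open>N'\<close> and that of \<open>f\<close> by
  \<open>M\<close>: the output prefix of \<open>g\<close> and the input prefix of \<open>f\<close>
  then both have length \<open>M + N'\<close>, and the forms can be chained.\<close>

lemma local_form_comp:
  assumes "local_form r g x h N M" "local_form r f (g x) h' N' M'" "x \<in> cantor r"
    and g: "\<And>y. y \<in> cantor r \<Longrightarrow> g y \<in> cantor r"
  shows "local_form r (f \<circ> g) x (h' \<circ> h) (N + N') (M' + M)"
proof -
  have 1: "local_form r g x h (N + N') (M + N')"
    using local_form_refine[OF assms(1,3)] .
  have 2: "local_form r f (g x) h' (M + N') (M' + M)"
    using local_form_refine[OF assms(2) g[OF assms(3)], of M] by (simp add: add.commute)
  show ?thesis
    unfolding local_form_def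
  proof (intro ballI impI)
    fix y assume y: "y \<in> cantor r" "\<forall>i<N + N'. y i = x i"
    have gy: "\<forall>i<M + N'. g y i = g x i" "\<forall>i. g y (M + N' + i) = h (y (N + N' + i))"
      using 1 y unfolding local_form_def by blast+
    then have "\<forall>i<M' + M. f (g y) i = f (g x) i" "\<forall>i. f (g y) (M' + M + i) = h' (g y (M + N' + i))"
      using 2 g[OF y(1)] unfolding local_form_def by blast+
    then show "(\<forall>i<M' + M. (f \<circ> g) y i = (f \<circ> g) x i) \<and>
        (\<forall>i. (f \<circ> g) y (M' + M + i) = (h' \<circ> h) (y (N + N' + i)))"
      using gy by simp
  qed
qed

lemma local_form_table:
  assumes "\<And>u. u \<in> cantor r \<Longrightarrow> f (conc p u) = conc q (h \<circ> u)" "x \<in> cantor r" "pref_inf p x"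
  shows "local_form r f x h (length p) (length q)"
  unfolding local_form_def
proof (intro ballI impI)
  obtain v where v: "v \<in> cantor r" "x = conc p v" using pref_infE[OF assms(3,2)] .
  fix y assume y: "y \<in> cantor r" "\<forall>i<length p. y i = x i"
  then have "pref_inf p y" using assms(3) by (simp add: pref_inf_def)
  then obtain u where u: "u \<in> cantor r" "y = conc p u" using pref_infE y(1) by blast
  show "(\<forall>i<length q. f y i = f x i) \<and> (\<forall>i. f y (length q + i) = h (y (length p + i)))"
    using assms(1)[OF u(1)] assms(1)[OF v(1)] u(2) v(2) by (simp add: conc_def)
qed

lemma local_perm_eq:
  assumes "r \<ge> 2" "x \<in> cantor r" "h permutes {..<r}" "local_form r f x h N M"
  shows "local_perm r f x = h"
  unfolding local_perm_def
  by (rule the_equality) (use assms local_form_unique in blast)+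

lemma Vset_local_form:
  assumes "f \<in> Vset r H" "perm_subgroup r H" "x \<in> cantor r"
  obtains h N M where "h \<in> H" "local_form r f x h N M"
proof -
  obtain P Q h where t: "prefix_code r P" "\<And>p. p \<in> P \<Longrightarrow> h p \<in> H"
    "\<And>p u. p \<in> P \<Longrightarrow> u \<in> cantor r \<Longrightarrow> f (conc p u) = conc (Q p) (h p \<circ> u)"
    using Vset_table[OF assms(1,2)] by metis
  obtain p where p: "p \<in> P" "pref_inf p x"
    using t(1) assms(3) by (auto simp: prefix_code_def)
  show thesis
    using that[OF t(2)[OF p(1)] local_form_table[OF t(3)[OF p(1)] assms(3) p(2)]] by simp
qed

lemma local_perm_in:
  assumes "f \<in> Vset r H" "perm_subgroup r H" "r \<ge> 2" "x \<in> cantor r"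
  shows "local_perm r f x \<in> H"
  using Vset_local_form[OF assms(1,2,4)] local_perm_eq[OF assms(3,4)] assms(2)
  by (metis (no_types, lifting) mem_Collect_eq perm_subgroup_def subsetD)

text \<open>This is the cocycle identity, which makes the action on pairs, and hence
  \<open>emb\<close>, respect composition.\<close>

lemma local_perm_comp:
  assumes "f \<in> Vset r H" "g \<in> Vset r H" "perm_subgroup r H" "r \<ge> 2" "x \<in> cantor r"
  shows "local_perm r (f \<circ> g) x = local_perm r f (g x) \<circ> local_perm r g x"
proof -
  have H: "h permutes {..<r}" if "h \<in> H" for h
    using assms(3) that by (auto simp: perm_subgroup_def)
  note gc = Vset_maps_cantor[OF assms(2,3)]
  obtain h N M where h: "h \<in> H" "local_form r g x h N M"
    using Vset_local_form[OF assms(2,3,5)] .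
  obtain h' N' M' where h': "h' \<in> H" "local_form r f (g x) h' N' M'"
    using Vset_local_form[OF assms(1,3) gc[OF assms(5)]] .
  have "local_perm r (f \<circ> g) x = h' \<circ> h"
    using local_perm_eq[OF assms(4,5) permutes_compose[OF H[OF h(1)] H[OF h'(1)]]]
      local_form_comp[OF h(2) h'(2) assms(5) gc] by blast
  moreover have "local_perm r g x = h" using local_perm_eq[OF assms(4,5) H[OF h(1)] h(2)] .
  moreover have "local_perm r f (g x) = h'"
    using local_perm_eq[OF assms(4) gc[OF assms(5)] H[OF h'(1)] h'(2)] .
  ultimately show ?thesis by simp
qed

section \<open>Substitution along a prefix code\<close>

text \<open>Empty images, for which the infinite concatenation need not exist, are given the junk letter \<open>0\<close>.\<close>

function subst_inf :: "(nat \<Rightarrow> nat list) \<Rightarrow> (nat \<Rightarrow> nat) \<Rightarrow> nat \<Rightarrow> nat" where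
  "subst_inf e x i =
     (if e (x 0) = [] then 0
      else if i < length (e (x 0)) then e (x 0) ! i
      else subst_inf e (\<lambda>j. x (Suc j)) (i - length (e (x 0))))"
  by auto
termination
proof (relation "measure (\<lambda>(e, x, i). i)")
  fix e :: "nat \<Rightarrow> nat list" and x :: "nat \<Rightarrow> nat" and i :: nat
  assume "e (x 0) \<noteq> []" "\<not> i < length (e (x 0))"
  then show "((e, \<lambda>j. x (Suc j), i - length (e (x 0))), e, x, i) \<in> measure (\<lambda>(e, x, i). i)"
    by (cases "e (x 0)") auto
qed simp

declare subst_inf.simps [simp del]

abbreviation subst_word :: "(nat \<Rightarrow> nat list) \<Rightarrow> nat list \<Rightarrow> nat list" where
  "subst_word e p \<equiv> concat (map e p)"

text \<open>Nonempty code words keep \<open>subst_inf\<close> out of its junk branch on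
  \<open>cantor n\<close> and drive the inductions on positions: removing the first block lowers the
  position.\<close>

locale code_substitution =
  fixes m n :: nat and e :: "nat \<Rightarrow> nat list" and A :: "nat list set"
  assumes code: "prefix_code m A" and enum: "bij_betw e {..<n} A"
    and nonempty: "\<And>s. s \<in> A \<Longrightarrow> s \<noteq> []"
begin

lemma e_in: "a < n \<Longrightarrow> e a \<in> A"
  using bij_betw_apply[OF enum] by simp

lemma e_words: "a < n \<Longrightarrow> e a \<in> words m"
  using e_in code by (auto simp: prefix_code_def)

lemma subst_inf_rec:
  assumes "x \<in> cantor n"
  shows "subst_inf e x = conc (e (x 0)) (subst_inf e (\<lambda>j. x (Suc j)))"
proof
  fix i
  have "e (x 0) \<noteq> []" using assms e_in nonempty by (simp add: cantor_def)
  then show "subst_inf e x i = conc (e (x 0)) (subst_inf e (\<lambda>j. x (Suc j))) i"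
    by (subst subst_inf.simps) (simp add: conc_def)
qed

lemma subst_inf_in:
  assumes "x \<in> cantor n"
  shows "subst_inf e x \<in> cantor m"
proof -
  have "subst_inf e x i < m" for i
    using assms
  proof (induction i arbitrary: x rule: less_induct)
    case (less i)
    have x0: "x 0 < n" and tl: "(\<lambda>j. x (Suc j)) \<in> cantor n" using less.prems by (auto simp: cantor_def)
    show ?case
    proof (cases "i < length (e (x 0))")
      case True
      then show ?thesis using e_words[OF x0] subst_inf_rec[OF less.prems]
        by (simp add: conc_def words_def)
    next
      case False
      then have "subst_inf e x i = subst_inf e (\<lambda>j. x (Suc j)) (i - length (e (x 0)))"
        using subst_inf_rec[OF less.prems] by (simp add: conc_def)
      moreover have "i - length (e (x 0)) < i"
        using False nonempty[OF e_in[OF x0]] by (cases "e (x 0)") auto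
      ultimately show ?thesis using less.IH[OF _ tl] by simp
    qed
  qed
  then show ?thesis by (simp add: cantor_def)
qed

lemma subst_word_in: "p \<in> words n \<Longrightarrow> subst_word e p \<in> words m"
  using e_words by (fastforce simp: words_def)

lemma subst_inf_conc:
  "p \<in> words n \<Longrightarrow> x \<in> cantor n \<Longrightarrow> subst_inf e (conc p x) = conc (subst_word e p) (subst_inf e x)"
proof (induction p)
  case (Cons a p)
  then have "p \<in> words n" and c: "conc (a # p) x \<in> cantor n"
    by (auto simp: words_def intro: conc_in_cantor)
  moreover have "(\<lambda>j. conc (a # p) x (Suc j)) = conc p x" "conc (a # p) x 0 = a"
    by (auto simp: conc_def)
  ultimately show ?case
    using Cons subst_inf_rec[OF c] by (simp add: conc_append)
qed simp

text \<open>The code words of both first letters are prefixes of the same infinite word, so they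
  coincide. Cancelling them passes to the tails.\<close>

lemma subst_inf_inj:
  assumes "x \<in> cantor n" "y \<in> cantor n" "subst_inf e x = subst_inf e y"
  shows "x = y"
proof
  fix i
  show "x i = y i"
    using assms
  proof (induction i arbitrary: x y)
    have head: "x 0 = y 0" if "x \<in> cantor n" "y \<in> cantor n" "subst_inf e x = subst_inf e y" for x y
    proof -
      have xy: "x 0 < n" "y 0 < n" using that by (auto simp: cantor_def)
      have "pref_inf (e (x 0)) (subst_inf e x)" "pref_inf (e (y 0)) (subst_inf e x)"
        using subst_inf_rec that by (metis pref_inf_conc)+
      then have "e (x 0) = e (y 0)"
        using code subst_inf_in[OF that(1)] e_in xy unfolding prefix_code_def by blast
      then show ?thesis using enum xy by (auto simp: bij_betw_def inj_on_def)
    qed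
    case 0
    then show ?case by (rule head)
    case (Suc i)
    have "(\<lambda>j. x (Suc j)) \<in> cantor n" "(\<lambda>j. y (Suc j)) \<in> cantor n"
      using Suc.prems by (auto simp: cantor_def)
    moreover have "subst_inf e (\<lambda>j. x (Suc j)) = subst_inf e (\<lambda>j. y (Suc j))"
      using subst_inf_rec[OF Suc.prems(1)] subst_inf_rec[OF Suc.prems(2)] Suc.prems(3) head[OF Suc.prems]
      by (metis conc_cancel)
    ultimately show ?case using Suc.IH by blast
  qed
qed

text \<open>Every infinite word starts with a code word, so it can be decoded by splitting off code
  words forever.\<close>

lemma subst_inf_surj:
  assumes "z \<in> cantor m"
  obtains x where "x \<in> cantor n" "z = subst_inf e x"
proof -
  have "\<exists>ad. fst ad < n \<and> snd ad \<in> cantor m \<and> z = conc (e (fst ad)) (snd ad)" if z: "z \<in> cantor m" for z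
  proof -
    obtain s where s: "s \<in> A" "pref_inf s z" using code z by (auto simp: prefix_code_def)
    obtain z' where "z' \<in> cantor m" "z = conc s z'" using pref_infE[OF s(2) z] .
    moreover obtain a where "a < n" "e a = s" using s(1) enum by (auto simp: bij_betw_def)
    ultimately show ?thesis by (intro exI[of _ "(a, z')"]) simp
  qed
  then obtain ad where ad: "\<And>z. z \<in> cantor m \<Longrightarrow>
      fst (ad z) < n \<and> snd (ad z) \<in> cantor m \<and> z = conc (e (fst (ad z))) (snd (ad z))"
    by metis
  \<comment> \<open>\<open>rest\<close> strips the first code word, and \<open>dec z j\<close> is
    the letter of the code word found after \<open>j\<close> strips. Dropping the first letter of
    \<open>dec z\<close> therefore amounts to decoding \<open>rest z\<close>.\<close>
  define rest where "rest = snd \<circ> ad"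
  define dec where "dec z j = fst (ad ((rest ^^ j) z))" for z j
  have rest: "(rest ^^ j) z \<in> cantor m" if "z \<in> cantor m" for z j
    using that ad by (induction j) (auto simp: rest_def)
  have dec_in: "dec z \<in> cantor n" if "z \<in> cantor m" for z
    using ad[OF rest[OF that]] by (auto simp: cantor_def dec_def)
  have "subst_inf e (dec z) i = z i" if "z \<in> cantor m" for z i
    using that
  proof (induction i arbitrary: z rule: less_induct)
    case (less i)
    have tl: "(\<lambda>j. dec z (Suc j)) = dec (rest z)"
      by (simp add: dec_def funpow_swap1 fun_eq_iff)
    have rz: "rest z \<in> cantor m" using rest[OF less.prems, of 1] by simp
    have z: "z = conc (e (dec z 0)) (rest z)" using ad[OF less.prems] by (simp add: dec_def rest_def)
    have d0: "dec z 0 < n" using dec_in[OF less.prems] by (simp add: cantor_def)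
    have sd: "subst_inf e (dec z) = conc (e (dec z 0)) (subst_inf e (dec (rest z)))"
      using subst_inf_rec[OF dec_in[OF less.prems]] tl by simp
    show ?case
    proof (cases "i < length (e (dec z 0))")
      case True
      then show ?thesis using fun_cong[OF sd, of i] fun_cong[OF z, of i] by (simp add: conc_def)
    next
      case False
      have "i - length (e (dec z 0)) < i"
        using False nonempty[OF e_in[OF d0]] by (cases "e (dec z 0)") auto
      then show ?thesis using less.IH[OF _ rz] False fun_cong[OF sd, of i] fun_cong[OF z, of i]
        by (simp add: conc_def)
    qed
  qed
  then have "z = subst_inf e (dec z)" using assms by auto
  then show thesis using that dec_in[OF assms] by blast
qed

text \<open>For the direction from the substituted word back to \<open>x\<close>, surjectivity shows
  that what follows the prefix is itself the substitution of some \<open>y\<close>, and injectivity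
  then gives \<open>x = conc p y\<close>.\<close>

lemma pref_inf_subst_iff:
  assumes "p \<in> words n" "x \<in> cantor n"
  shows "pref_inf (subst_word e p) (subst_inf e x) \<longleftrightarrow> pref_inf p x"
proof
  assume "pref_inf p x"
  then obtain y where "y \<in> cantor n" "x = conc p y" using pref_infE assms(2) by blast
  then show "pref_inf (subst_word e p) (subst_inf e x)"
    using subst_inf_conc[OF assms(1)] by simp
next
  assume "pref_inf (subst_word e p) (subst_inf e x)"
  then obtain z where z: "z \<in> cantor m" "subst_inf e x = conc (subst_word e p) z"
    using pref_infE subst_inf_in assms(2) by blast
  obtain y where y: "y \<in> cantor n" "z = subst_inf e y" using subst_inf_surj[OF z(1)] .
  then have "subst_inf e x = subst_inf e (conc p y)" using z(2) subst_inf_conc[OF assms(1)] by simp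
  then have "x = conc p y"
    using subst_inf_inj assms y(1) conc_in_cantor by blast
  then show "pref_inf p x" by simp
qed

end

section \<open>The embedding\<close>

text \<open>The words \<open>w k\<close> are the addresses of the copies of C_n, one for each
  \<open>k\<close> in \<open>H\<close>. Distinct words of the same length \<open>L\<close> have
  disjoint cones.\<close>

locale cone_embedding = code_substitution +
  fixes H :: "(nat \<Rightarrow> nat) set" and L :: nat and w :: "(nat \<Rightarrow> nat) \<Rightarrow> nat list"
  assumes m_pos: "m > 0" and n_ge2: "n \<ge> 2"
    and H: "perm_subgroup n H"
    and w_inj: "inj_on w H"
    and w_in: "\<And>k. k \<in> H \<Longrightarrow> w k \<in> words m \<and> length (w k) = L"
begin

lemma H_permutes: "k \<in> H \<Longrightarrow> k permutes {..<n}"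
  using H by (auto simp: perm_subgroup_def)

lemma H_comp: "h \<in> H \<Longrightarrow> k \<in> H \<Longrightarrow> h \<circ> k \<in> H"
  using H by (auto simp: perm_subgroup_def)

lemma H_id: "id \<in> H"
  using H by (auto simp: perm_subgroup_def)

lemma H_inv: "k \<in> H \<Longrightarrow> Hilbert_Choice.inv k \<in> H"
  using H by (auto simp: perm_subgroup_def)

lemma H_finite: "finite H"
  using H finite_permutations[of "{..<n}"] by (auto simp: perm_subgroup_def intro: finite_subset)

lemma comp_inv_cancel:
  assumes "k \<in> H"
  shows "k \<circ> Hilbert_Choice.inv k = id" "Hilbert_Choice.inv k \<circ> k = id"
  using permutes_inv_o[OF H_permutes[OF assms]] .

lemma inv_comp_cantor: "k \<in> H \<Longrightarrow> x \<in> cantor n \<Longrightarrow> Hilbert_Choice.inv k \<circ> x \<in> cantor n"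
  by (rule permutes_comp_cantor[OF H_permutes[OF H_inv]])

lemma inv_map_words: "k \<in> H \<Longrightarrow> p \<in> words n \<Longrightarrow> map (Hilbert_Choice.inv k) p \<in> words n"
  by (rule permutes_map_words[OF H_permutes[OF H_inv]])

section \<open>Charts: placing the product of \<open>H\<close> and C_n inside C_m\<close>

definition chart :: "(nat \<Rightarrow> nat) \<Rightarrow> (nat \<Rightarrow> nat) \<Rightarrow> nat \<Rightarrow> nat" where
  "chart k x = conc (w k) (subst_inf e (Hilbert_Choice.inv k \<circ> x))"

definition chart_word :: "(nat \<Rightarrow> nat) \<Rightarrow> nat list \<Rightarrow> nat list" where
  "chart_word k p = w k @ subst_word e (map (Hilbert_Choice.inv k) p)"

lemma chart_in: "k \<in> H \<Longrightarrow> x \<in> cantor n \<Longrightarrow> chart k x \<in> cantor m"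
  unfolding chart_def using w_in inv_comp_cantor subst_inf_in conc_in_cantor by blast

lemma chart_word_in: "k \<in> H \<Longrightarrow> p \<in> words n \<Longrightarrow> chart_word k p \<in> words m"
  using w_in subst_word_in[OF inv_map_words] unfolding chart_word_def
  by (auto simp: words_def)

lemma chart_inj:
  assumes "k \<in> H" "k' \<in> H" "x \<in> cantor n" "x' \<in> cantor n" "chart k x = chart k' x'"
  shows "k = k' \<and> x = x'"
proof -
  have *: "w k = w k' \<and> subst_inf e (Hilbert_Choice.inv k \<circ> x) = subst_inf e (Hilbert_Choice.inv k' \<circ> x')"
    using assms w_in by (intro conc_cancel_same_length) (auto simp: chart_def)
  then have k: "k = k'" using w_inj assms by (auto simp: inj_on_def)
  with * have "Hilbert_Choice.inv k \<circ> x = Hilbert_Choice.inv k \<circ> x'"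
    using subst_inf_inj inv_comp_cantor assms by blast
  then have "k \<circ> Hilbert_Choice.inv k \<circ> x = k \<circ> Hilbert_Choice.inv k \<circ> x'" by (simp add: comp_assoc)
  with k show ?thesis using comp_inv_cancel[OF assms(1)] by simp
qed

text \<open>The inverse of \<open>k\<close> built into \<open>chart\<close> undoes the twist of the
  tail, so the image tail \<open>subst_inf e u\<close> does not depend on \<open>k\<close>. This is
  why permutations of tails turn into pure prefix replacements.\<close>

lemma chart_conc:
  assumes "k \<in> H" "p \<in> words n" "u \<in> cantor n"
  shows "chart k (conc p (k \<circ> u)) = conc (chart_word k p) (subst_inf e u)"
proof -
  have "Hilbert_Choice.inv k \<circ> (k \<circ> u) = u"
    using comp_inv_cancel[OF assms(1)] by (simp flip: comp_assoc)
  then show ?thesis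
    using subst_inf_conc[OF inv_map_words[OF assms(1,2)] assms(3)]
    by (simp add: chart_def chart_word_def comp_conc conc_append)
qed

lemma pref_inf_chart_iff:
  assumes "k \<in> H" "p \<in> words n" "x \<in> cantor n"
  shows "pref_inf (chart_word k p) (chart k x) \<longleftrightarrow> pref_inf p x"
proof -
  have "inj (Hilbert_Choice.inv k)" using permutes_inj[OF H_permutes[OF H_inv[OF assms(1)]]] .
  then have "pref_inf (map (Hilbert_Choice.inv k) p) (Hilbert_Choice.inv k \<circ> x) \<longleftrightarrow> pref_inf p x"
    by (auto simp: pref_inf_def inj_eq)
  then show ?thesis
    using pref_inf_subst_iff[OF inv_map_words[OF assms(1,2)] inv_comp_cantor[OF assms(1,3)]]
    by (simp add: chart_def chart_word_def pref_inf_append)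
qed

lemma chart_surj:
  assumes "z \<in> cantor m" "pref_inf (w k) z" "k \<in> H"
  obtains x where "x \<in> cantor n" "z = chart k x"
proof -
  obtain y where y: "y \<in> cantor m" "z = conc (w k) y" using pref_infE[OF assms(2,1)] .
  obtain x where x: "x \<in> cantor n" "y = subst_inf e x" using subst_inf_surj[OF y(1)] .
  have "Hilbert_Choice.inv k \<circ> (k \<circ> x) = x"
    using comp_inv_cancel[OF assms(3)] by (simp flip: comp_assoc)
  then show thesis
    using that[of "k \<circ> x"] permutes_comp_cantor[OF H_permutes[OF assms(3)] x(1)] x y
    by (simp add: chart_def)
qed

section \<open>Partition of C_m into cones\<close>

definition spare_words :: "nat list set" where
  "spare_words = {v \<in> words m. length v = L \<and> v \<notin> w ` H}"

text \<open>The left summand subdivides each copy of C_n along the code \<open>S\<close>. The right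
  summand covers the rest of C_m, where the embedded maps are the identity.\<close>

definition cone_index :: "nat list set \<Rightarrow> ((nat \<Rightarrow> nat) \<times> nat list + nat list) set" where
  "cone_index S = (H \<times> S) <+> spare_words"

fun cone_word :: "(nat \<Rightarrow> nat) \<times> nat list + nat list \<Rightarrow> nat list" where
  "cone_word (Inl (k, p)) = chart_word k p"
| "cone_word (Inr v) = v"

lemma spare_words_finite: "finite spare_words"
proof (rule finite_subset)
  show "spare_words \<subseteq> {v. set v \<subseteq> {..<m} \<and> length v = L}"
    by (auto simp: spare_words_def words_def)
qed (simp add: finite_lists_length_eq)

text \<open>The first \<open>L\<close> letters of \<open>z\<close> decide. If they spell some
  \<open>w k\<close>, then \<open>z\<close> lies in the chart of \<open>k\<close> and its preimage
  has one prefix in \<open>S\<close>; otherwise they are themselves the only fitting word.\<close>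

lemma cone_word_ex1:
  assumes S: "prefix_code n S" and z: "z \<in> cantor m"
  shows "\<exists>!i. i \<in> cone_index S \<and> pref_inf (cone_word i) z"
proof -
  define v where "v = map z [0..<L]"
  have v: "pref_inf v z" "length v = L" "v \<in> words m"
    using z by (auto simp: v_def pref_inf_def words_def cantor_def)
  \<comment> \<open>A chart word begins with \<open>w k\<close>, which has length \<open>L\<close>,
    so its first \<open>L\<close> letters must be those of \<open>z\<close>.\<close>
  have wk: "w k = v" if "k \<in> H" "pref_inf (chart_word k p) z" for k p
    using that w_in v pref_inf_appendD pref_inf_length_unique unfolding chart_word_def by metis
  show ?thesis
  proof (cases "v \<in> w ` H")
    case True
    then obtain k where k: "k \<in> H" "v = w k" by blast
    obtain x where x: "x \<in> cantor n" "z = chart k x" using chart_surj[OF z _ k(1)] v(1) k(2) by blast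
    obtain p where p: "p \<in> S" "pref_inf p x" "\<And>p'. p' \<in> S \<Longrightarrow> pref_inf p' x \<Longrightarrow> p' = p"
      using S x(1) unfolding prefix_code_def by metis
    have Sw: "S \<subseteq> words n" using S by (simp add: prefix_code_def)
    show ?thesis
    proof (rule ex1I[of _ "Inl (k, p)"])
      show "Inl (k, p) \<in> cone_index S \<and> pref_inf (cone_word (Inl (k, p))) z"
        using k(1) p(1,2) x(2) pref_inf_chart_iff[OF k(1) _ x(1), of p] Sw
        by (simp add: cone_index_def subset_iff Plus_def)
      fix i assume i: "i \<in> cone_index S \<and> pref_inf (cone_word i) z"
      show "i = Inl (k, p)"
      proof (cases i)
        case (Inl kp)
        obtain k' p' where kp: "kp = (k', p')" by fastforce
        have *: "k' \<in> H" "p' \<in> S" "pref_inf (chart_word k' p') z"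
          using i Inl kp by (auto simp: cone_index_def)
        then have "k' = k" using wk k w_inj by (metis inj_onD)
        moreover from this * have "pref_inf p' x" using pref_inf_chart_iff[OF k(1)] x Sw by blast
        ultimately show ?thesis using p(3) * Inl kp by blast
      next
        case (Inr v')
        then have "v' = v" using i v pref_inf_length_unique by (auto simp: cone_index_def spare_words_def)
        then show ?thesis using i Inr True by (auto simp: cone_index_def spare_words_def)
      qed
    qed
  next
    case False
    show ?thesis
    proof (rule ex1I[of _ "Inr v"])
      show "Inr v \<in> cone_index S \<and> pref_inf (cone_word (Inr v)) z"
        using v False by (auto simp: cone_index_def spare_words_def)
      fix i assume i: "i \<in> cone_index S \<and> pref_inf (cone_word i) z"
      show "i = Inr v"
      proof (cases i)
        case (Inl kp)
        then show ?thesis using i wk False by (cases kp) (auto simp: cone_index_def)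
      next
        case (Inr v')
        then show ?thesis using i v pref_inf_length_unique by (auto simp: cone_index_def spare_words_def)
      qed
    qed
  qed
qed

lemma cone_code:
  assumes "prefix_code n S"
  shows "prefix_code m (cone_word ` cone_index S)" "inj_on cone_word (cone_index S)" "finite (cone_index S)"
proof -
  show fin: "finite (cone_index S)"
    using assms H_finite spare_words_finite by (auto simp: cone_index_def prefix_code_def)
  have "cone_word i \<in> words m" if "i \<in> cone_index S" for i
    using that assms chart_word_in by (auto simp: cone_index_def spare_words_def prefix_code_def)
  from prefix_code_family[OF m_pos fin this cone_word_ex1[OF assms]]
  show "prefix_code m (cone_word ` cone_index S)" "inj_on cone_word (cone_index S)" by blast+
qed

section \<open>The action on charts as a map of C_m\<close>

definition emb :: "((nat \<Rightarrow> nat) \<Rightarrow> nat \<Rightarrow> nat) \<Rightarrow> (nat \<Rightarrow> nat) \<Rightarrow> nat \<Rightarrow> nat" where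
  "emb f z = (if \<exists>k\<in>H. \<exists>x\<in>cantor n. z = chart k x
     then THE y. \<exists>k\<in>H. \<exists>x\<in>cantor n. z = chart k x \<and> y = chart (local_perm n f x \<circ> k) (f x)
     else z)"

text \<open>By \<open>chart_inj\<close> a point of C_m has at most one pair of chart coordinates, so
  the description in \<open>emb\<close> is unambiguous.\<close>

lemma emb_chart:
  assumes "k \<in> H" "x \<in> cantor n"
  shows "emb f (chart k x) = chart (local_perm n f x \<circ> k) (f x)"
proof -
  have "(THE y. \<exists>k'\<in>H. \<exists>x'\<in>cantor n. chart k x = chart k' x' \<and> y = chart (local_perm n f x' \<circ> k') (f x'))
      = chart (local_perm n f x \<circ> k) (f x)"
    using assms chart_inj by (intro the_equality) blast+
  then show ?thesis using assms unfolding emb_def by auto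
qed

lemma emb_outside: "(\<And>k x. k \<in> H \<Longrightarrow> x \<in> cantor n \<Longrightarrow> z \<noteq> chart k x) \<Longrightarrow> emb f z = z"
  by (auto simp: emb_def)

lemma emb_comp:
  assumes "f \<in> Vset n H" "g \<in> Vset n H"
  shows "emb (f \<circ> g) = emb f \<circ> emb g"
proof
  fix z
  show "emb (f \<circ> g) z = (emb f \<circ> emb g) z"
  proof (cases "\<exists>k\<in>H. \<exists>x\<in>cantor n. z = chart k x")
    case True
    then obtain k x where z: "k \<in> H" "x \<in> cantor n" "z = chart k x" by blast
    \<comment> \<open>The image under \<open>emb g\<close> is again a chart point, so
      \<open>emb_chart\<close> applies a second time, and the cocycle identity matches the two
      sides.\<close>
    have "local_perm n g x \<circ> k \<in> H" "g x \<in> cantor n"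
      using H_comp local_perm_in[OF assms(2) H n_ge2 z(2)] Vset_maps_cantor[OF assms(2) H z(2)] z by auto
    then show ?thesis
      using z by (simp add: emb_chart local_perm_comp[OF assms H n_ge2 z(2)] comp_assoc)
  next
    case False
    then show ?thesis by (simp add: emb_outside)
  qed
qed

lemma emb_inj: "inj_on emb (Vset n H)"
proof (rule inj_onI)
  fix f g assume fg: "f \<in> Vset n H" "g \<in> Vset n H" "emb f = emb g"
  show "f = g"
  proof
    fix x
    show "f x = g x"
    proof (cases "x \<in> cantor n")
      case True
      \<comment> \<open>The copy of C_n at \<open>k = id\<close> suffices: the second chart
        coordinate of the image recovers \<open>f x\<close>.\<close>
      have "chart (local_perm n f x) (f x) = chart (local_perm n g x) (g x)"
        using emb_chart[OF H_id True] fg(3) by (metis comp_id)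
      then show ?thesis
        using chart_inj local_perm_in[OF _ H n_ge2 True] Vset_maps_cantor[OF _ H True] fg by blast
    next
      case False
      then show ?thesis using fg by (simp add: Vset_def)
    qed
  qed
qed

text \<open>A table of \<open>f\<close> with source code \<open>P\<close> yields one of
  \<open>emb f\<close> on the cones indexed by \<open>cone_index P\<close>. By
  \<open>chart_conc\<close> tails are carried over unchanged, so every permutation in the new table
  is \<open>id\<close>.\<close>

lemma emb_in_Vset:
  assumes f: "f \<in> Vset n H" and G: "id \<in> G"
  shows "emb f \<in> Vset m G"
proof -
  obtain P Q h where P: "prefix_code n P" and Qinj: "inj_on Q P" and Q: "prefix_code n (Q ` P)"
    and h: "\<And>p. p \<in> P \<Longrightarrow> h p \<in> H"
    and fp: "\<And>p u. p \<in> P \<Longrightarrow> u \<in> cantor n \<Longrightarrow> f (conc p u) = conc (Q p) (h p \<circ> u)"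
    using Vset_table[OF f H] by metis
  have words: "P \<subseteq> words n" "Q ` P \<subseteq> words n"
    using P Q by (auto simp: prefix_code_def)
  define move where "move = map_sum (\<lambda>(k :: nat \<Rightarrow> nat, p). (h p \<circ> k, Q p)) (id :: nat list \<Rightarrow> nat list)"
  have move_inj: "inj_on move (cone_index P)"
  proof (rule inj_onI)
    fix i j assume ij: "i \<in> cone_index P" "j \<in> cone_index P" "move i = move j"
    show "i = j"
    proof (cases i)
      case (Inl kp)
      obtain k p where kp: "kp = (k, p)" by fastforce
      obtain k' p' where j: "j = Inl (k', p')" using ij Inl by (cases j) (auto simp: move_def)
      have pP: "p \<in> P" "p' \<in> P" using ij Inl kp j by (auto simp: cone_index_def)
      have eq: "h p \<circ> k = h p' \<circ> k'" "Q p = Q p'" using ij(3) Inl kp j by (auto simp: move_def)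
      \<comment> \<open>This must come first: only for \<open>p = p'\<close> do both sides carry the
        same factor \<open>h p\<close>, which can then be cancelled.\<close>
      have p: "p = p'" using inj_onD[OF Qinj eq(2) pP] .
      have "Hilbert_Choice.inv (h p) \<circ> h p \<circ> k = Hilbert_Choice.inv (h p) \<circ> h p \<circ> k'"
        using eq(1) p by (simp add: comp_assoc)
      then have "k = k'" using comp_inv_cancel[OF h[OF pP(1)]] by simp
      then show ?thesis using Inl kp j p by simp
    next
      case (Inr v)
      then show ?thesis using ij by (cases j) (auto simp: move_def)
    qed
  qed
  have move_image: "move ` cone_index P = cone_index (Q ` P)"
  proof
    show "move ` cone_index P \<subseteq> cone_index (Q ` P)"
      using h H_comp by (auto simp: cone_index_def move_def)
    show "cone_index (Q ` P) \<subseteq> move ` cone_index P"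
    proof
      fix i assume i: "i \<in> cone_index (Q ` P)"
      show "i \<in> move ` cone_index P"
      proof (cases i)
        case (Inl kq)
        then obtain k p where kp: "kq = (k, Q p)" "k \<in> H" "p \<in> P"
          using i by (cases kq) (auto simp: cone_index_def)
        have "h p \<circ> (Hilbert_Choice.inv (h p) \<circ> k) = k"
          using comp_inv_cancel[OF h[OF kp(3)]] by (simp flip: comp_assoc)
        then have "i = move (Inl (Hilbert_Choice.inv (h p) \<circ> k, p))"
          using Inl kp by (simp add: move_def)
        moreover have "Inl (Hilbert_Choice.inv (h p) \<circ> k, p) \<in> cone_index P"
          using kp H_comp H_inv h by (auto simp: cone_index_def)
        ultimately show ?thesis by blast
      next
        case (Inr v)
        then have "i = move i" "i \<in> cone_index P" using i by (auto simp: move_def cone_index_def)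
        then show ?thesis by blast
      qed
    qed
  qed
  show ?thesis
  proof (rule Vset_intro[where I = "cone_index P" and p = cone_word and q = "cone_word \<circ> move" and h = "\<lambda>_. id"])
    show "finite (cone_index P)" "inj_on cone_word (cone_index P)"
      "prefix_code m (cone_word ` cone_index P)"
      using cone_code[OF P] by auto
    show "inj_on (cone_word \<circ> move) (cone_index P)"
      using comp_inj_on[OF move_inj] cone_code(2)[OF Q] move_image by simp
    show "prefix_code m ((cone_word \<circ> move) ` cone_index P)"
      using cone_code(1)[OF Q] move_image by (metis image_comp)
  next
    fix z assume "z \<notin> cantor m"
    then show "emb f z = z" using chart_in by (intro emb_outside) blast
  next
    fix i u assume i: "i \<in> cone_index P" and u: "u \<in> cantor m"
    obtain x where x: "x \<in> cantor n" "u = subst_inf e x" using subst_inf_surj[OF u] .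
    have "emb f (conc (cone_word i) u) = conc (cone_word (move i)) u"
    proof (cases i)
      case (Inl kp)
      then obtain k p where kp: "i = Inl (k, p)" "k \<in> H" "p \<in> P" using i by (auto simp: cone_index_def)
      have kx: "k \<circ> x \<in> cantor n" using permutes_comp_cantor[OF H_permutes[OF kp(2)] x(1)] .
      have c: "conc p (k \<circ> x) \<in> cantor n" using kp words kx conc_in_cantor by blast
      have lp: "local_perm n f (conc p (k \<circ> x)) = h p"
        using local_perm_eq[OF n_ge2 c H_permutes[OF h[OF kp(3)]] local_form_table[OF fp[OF kp(3)] c]]
        by simp
      have "emb f (conc (cone_word i) u) = emb f (chart k (conc p (k \<circ> x)))"
        using kp words x by (subst chart_conc) auto
      \<comment> \<open>The tail is now twisted by the same permutation \<open>h p \<circ> k\<close>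
        that labels the chart, so \<open>chart_conc\<close> applies again and returns the original
        tail \<open>u\<close>.\<close>
      also have "\<dots> = chart (h p \<circ> k) (conc (Q p) ((h p \<circ> k) \<circ> x))"
        using emb_chart[OF kp(2) c] lp fp[OF kp(3) kx] by (simp add: comp_assoc)
      also have "\<dots> = conc (cone_word (move i)) u"
        using kp words x H_comp h by (subst chart_conc) (auto simp: move_def)
      finally show ?thesis .
    next
      case (Inr v)
      then have v: "v \<in> spare_words" using i by (auto simp: cone_index_def)
      \<comment> \<open>A spare word has the length of every address \<open>w k\<close> but equals
        none of them, so its cone meets no chart.\<close>
      have "conc v u \<noteq> chart k x" if "k \<in> H" for k x
        using v that w_in conc_cancel_same_length[of v u "w k"]
        by (auto simp: chart_def spare_words_def)
      then have "emb f (conc v u) = conc v u" by (intro emb_outside) blast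
      then show ?thesis using Inr by (simp add: move_def)
    qed
    then show "emb f (conc (cone_word i) u) = conc ((cone_word \<circ> move) i) (id \<circ> u)" by simp
  qed (use G in auto)
qed

end

lemma Vgrp_embedding_of_prefix_code:
  assumes "m \<ge> 2" "card A \<ge> 2" "prefix_code m A" "perm_subgroup (card A) H" "id \<in> G"
  shows "\<exists>\<phi>. \<phi> \<in> hom (Vgrp (card A) H) (Vgrp m G) \<and> inj_on \<phi> (carrier (Vgrp (card A) H))"
proof -
  have "finite A" using assms(3) by (simp add: prefix_code_def)
  then obtain e where e: "bij_betw e {..<card A} A"
    by (metis atLeast0LessThan ex_bij_betw_nat_finite)
  have finH: "finite H"
    using assms(4) finite_permutations[of "{..<card A}"] by (auto simp: perm_subgroup_def intro: finite_subset)
  \<comment> \<open>This length provides enough addresses: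
    \<open>card H \<le> 2 ^ card H \<le> m ^ L\<close>, the number of words of length
    \<open>L\<close>.\<close>
  define L where "L = card H"
  define W where "W = {v. set v \<subseteq> {..<m} \<and> length v = L}"
  have "card H \<le> 2 ^ L" unfolding L_def using less_exp[of "card H"] by linarith
  also have "\<dots> \<le> m ^ L" using assms(1) by (rule power_mono) simp
  also have "\<dots> = card W" by (simp add: W_def card_lists_length_eq)
  finally obtain w where w: "w ` H \<subseteq> W" "inj_on w H"
    using card_le_inj[OF finH] by (metis W_def finite_lists_length_eq finite_lessThan)
  interpret cone_embedding m "card A" e A H L w
  proof
    show "s \<noteq> []" if "s \<in> A" for s
      using prefix_code_nonempty_words[OF assms(3,2) _ that] assms(1) by simp
    show "w k \<in> words m \<and> length (w k) = L" if "k \<in> H" for k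
      using w(1) that by (auto simp: W_def words_def)
  qed (use assms e w in auto)
  show ?thesis
    using emb_inj emb_comp emb_in_Vset assms(5) by (intro exI[of _ emb]) (auto simp: Vgrp_def hom_def)
qed

theorem theorem1p1:
  fixes m n :: nat and G H :: "(nat \<Rightarrow> nat) set" and A :: "nat list set"
  assumes "m \<ge> 2" and "n \<ge> 2" and "m < n"
    and "perm_subgroup m G" and "perm_subgroup n H"
    and "prefix_code m A" and "card A = n"
    and "root_well_defined G A"
    and "cyclically_isomorphic n (root_group G A) H"
  shows "\<exists>\<phi>. \<phi> \<in> hom (Vgrp n H) (Vgrp m G) \<and> inj_on \<phi> (carrier (Vgrp n H))"
  using Vgrp_embedding_of_prefix_code[of m A H G] assms by (simp add: perm_subgroup_def)

end
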